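(* Let $s$ be a positive integer. For every positive integer $N$ and every integer $n \geq 0$, the number of partitions of $n$ into parts each of which is not divisible by $s$ and is $\leq sN$ equals the number of partitions of $n$ into parts each $\leq sN$ in which every part $\leq N$ occurs at most $s-1$ times (parts in the range from $N+1$ to $sN$ may be repeated without restriction).
   Context: A partition of a nonnegative integer $n$ is a finite multiset of positive integers (its parts) with sum $n$; the empty partition is the unique partition of $0$. "Occurs at most $s-1$ times" means that the multiplicity of the part in the multiset is at most $s-1$. *)

theory Defs
  imports "HOL-Library.Multiset"
begin

definition partitions_of :: "nat \<Rightarrow> nat multiset set" where
  "partitions_of n = {p. (\<forall>x\<in>#p. 0 < x) \<and> \<Sum>\<^sub># p = n}"

(* Hence card counts the elements of every subset of partitions_of n. *)
lemma finite_partitions_of: "finite (partitions_of n)"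
proof -
  have "size p \<le> \<Sum>\<^sub># p" if "\<forall>x\<in>#p. 0 < x" for p :: "nat multiset"
    using that by (induction p) auto
  then have "partitions_of n \<subseteq> mset ` {xs. set xs \<subseteq> {..n} \<and> length xs \<le> n}"
  proof (intro subsetI)
    fix p
    assume size_le: "\<And>p :: nat multiset. \<forall>x\<in>#p. 0 < x \<Longrightarrow> size p \<le> \<Sum>\<^sub># p"
      and p: "p \<in> partitions_of n"
    obtain xs where xs: "mset xs = p"
      using ex_mset by blast
    have "x \<le> n" if "x \<in># p" for x
      using p multi_member_split[OF that] by (auto simp: partitions_of_def)
    moreover have "size p \<le> n"
      using p size_le[of p] by (auto simp: partitions_of_def)
    ultimately show "p \<in> mset ` {xs. set xs \<subseteq> {..n} \<and> length xs \<le> n}"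
      using xs by (auto intro!: image_eqI[of _ _ xs])
  qed
  then show ?thesis
    by (rule finite_subset) (simp add: finite_lists_length_le)
qed

end

theory Submission
  imports Defs
begin

text \<open>
  Exchanging \<open>s\<close> copies of a part \<open>j\<close> for one part \<open>s * j\<close> turns the restriction
  that \<open>s * j\<close> does not occur into the restriction that \<open>j\<close> occurs at most \<open>s - 1\<close> times.
  Doing this for \<open>j = 1, \<dots>, N\<close> in increasing order leads from the first family of partitions
  to the second: when \<open>j\<close> is reached it is unrestricted, because a multiple \<open>j\<close> of \<open>s\<close> has
  already been released at the earlier stage \<open>j div s\<close>.
\<close>

text \<open>Division with remainder makes the exchange reversible: the remainder of the multiplicity
  of \<open>j\<close> modulo \<open>s\<close> stays on \<open>j\<close>, and the quotient becomes
  the multiplicity of \<open>s * j\<close>. The predicate \<open>R\<close> carries along any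
  condition blind to these two multiplicities.\<close>

lemma card_partitions_exchange:
  fixes s j n :: nat
  assumes s: "2 \<le> s" and j: "0 < j"
    and R: "\<And>p q. (\<And>x. x \<noteq> j \<Longrightarrow> x \<noteq> s * j \<Longrightarrow> count p x = count q x) \<Longrightarrow> R p \<Longrightarrow> R q"
  shows "card {p \<in> partitions_of n. R p \<and> s * j \<notin># p} =
         card {p \<in> partitions_of n. R p \<and> count p j < s}"
proof -
  define f where "f p = p - replicate_mset (s * (count p j div s)) j
      + replicate_mset (count p j div s) (s * j)" for p :: "nat multiset"
  define g where "g p = p - replicate_mset (count p (s * j)) (s * j)
      + replicate_mset (s * count p (s * j)) j" for p :: "nat multiset"
  have ne: "s * j \<noteq> j" using s j by simp
  have count_f: "count (f p) x = (if x = j then count p j mod s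
      else if x = s * j then count p x + count p j div s else count p x)" for p x
    using ne by (auto simp: f_def minus_mult_div_eq_mod)
  have count_g: "count (g p) x = (if x = s * j then 0
      else if x = j then count p j + s * count p (s * j) else count p x)" for p x
    using ne by (auto simp: g_def)
  have sum_f: "\<Sum>\<^sub># (f p) = \<Sum>\<^sub># p" for p
  proof -
    have "replicate_mset (s * (count p j div s)) j \<subseteq># p"
      by (simp flip: count_le_replicate_mset_subset_eq)
    from arg_cong[OF subset_mset.diff_add[OF this], of sum_mset] show ?thesis
      by (simp add: f_def ac_simps)
  qed
  have sum_g: "\<Sum>\<^sub># (g p) = \<Sum>\<^sub># p" for p
  proof -
    have "replicate_mset (count p (s * j)) (s * j) \<subseteq># p"
      by (simp flip: count_le_replicate_mset_subset_eq)
    from arg_cong[OF subset_mset.diff_add[OF this], of sum_mset] show ?thesis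
      by (simp add: g_def ac_simps)
  qed
  have pos: "\<forall>x\<in>#f p. 0 < x" "\<forall>x\<in>#g p. 0 < x" if "\<forall>x\<in>#p. 0 < x" for p
    using that s j by (auto simp: f_def g_def dest: in_diffD split: if_splits)
  have "bij_betw f {p \<in> partitions_of n. R p \<and> s * j \<notin># p}
                   {p \<in> partitions_of n. R p \<and> count p j < s}"
  proof (rule bij_betw_byWitness[where f' = g])
    show "\<forall>p \<in> {p \<in> partitions_of n. R p \<and> s * j \<notin># p}. g (f p) = p"
      by (auto intro!: multiset_eqI simp: count_f count_g not_in_iff ne)
    \<comment> \<open>Splitting gives \<open>j\<close> the multiplicity
      \<open>count p j + s * count p (s * j)\<close>. As \<open>count p j < s\<close>, dividing by
      \<open>s\<close> recovers both counts.\<close>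
    show "\<forall>p \<in> {p \<in> partitions_of n. R p \<and> count p j < s}. f (g p) = p"
      using ne s by (auto intro!: multiset_eqI simp: count_f count_g)
    have "R (f p)" if "R p" for p
      by (rule R[OF _ that]) (simp add: count_f)
    then show "f ` {p \<in> partitions_of n. R p \<and> s * j \<notin># p}
        \<subseteq> {p \<in> partitions_of n. R p \<and> count p j < s}"
      using s pos(1) by (auto simp: partitions_of_def sum_f count_f)
    have "R (g p)" if "R p" for p
      by (rule R[OF _ that]) (simp add: count_g)
    then show "g ` {p \<in> partitions_of n. R p \<and> count p j < s}
        \<subseteq> {p \<in> partitions_of n. R p \<and> s * j \<notin># p}"
      using pos(2) by (auto simp: partitions_of_def sum_g count_g not_in_iff)
  qed
  then show ?thesis
    by (rule bij_betw_same_card)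
qed

text \<open>The condition on the right interpolates between the two families. For
  \<open>k = 0\<close> its last clause excludes all multiples of \<open>s\<close>, since parts are
  positive; for \<open>k = N\<close> that clause follows from \<open>x \<le> s * N\<close>.\<close>

lemma card_partitions_stage:
  fixes s N n k :: nat
  assumes s: "2 \<le> s" and "k \<le> N"
  shows "card {p \<in> partitions_of n. \<forall>x\<in>#p. \<not> s dvd x \<and> x \<le> s * N} =
         card {p \<in> partitions_of n. \<forall>x\<in>#p. x \<le> s * N \<and> (x \<le> k \<longrightarrow> count p x < s)
                                      \<and> (s dvd x \<longrightarrow> x \<le> s * k)}"
  using \<open>k \<le> N\<close>
proof (induction k)
  case 0
  show ?case
    by (rule arg_cong[where f = card]) (fastforce simp: partitions_of_def)
next
  case (Suc k)
  let ?j = "Suc k"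
  \<comment> \<open>What stages \<open>k\<close> and \<open>Suc k\<close> demand alike: their
    conditions on all parts except the two being exchanged.\<close>
  define R where "R p \<longleftrightarrow> (\<forall>x\<in>#p. x \<noteq> ?j \<longrightarrow> x \<noteq> s * ?j \<longrightarrow>
      x \<le> s * N \<and> (x \<le> k \<longrightarrow> count p x < s) \<and> (s dvd x \<longrightarrow> x \<le> s * k))" for p
  have j_le: "?j \<le> s * N" "s * ?j \<le> s * N"
    using s Suc.prems mult_le_mono[of 1 s "?j" N] by (auto simp del: mult_Suc_right)
  \<comment> \<open>If \<open>s\<close> divides \<open>?j\<close>, then \<open>?j\<close> is at
    least 2, so \<open>k\<close> is positive and \<open>?j \<le> 2 * k\<close>. Stage
    \<open>k\<close> thus puts no restriction on \<open>?j\<close>.\<close>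
  have j_free: "?j \<le> s * k" if "s dvd ?j"
  proof -
    have "2 \<le> ?j" using dvd_imp_le[OF that] s by simp
    moreover have "2 * k \<le> s * k" using s by simp
    ultimately show ?thesis by linarith
  qed
  have "?j < s * ?j"
    using s by (simp del: mult_Suc_right)
  then have less_j: "k < s * ?j" "?j < s * ?j"
    by (rule Suc_lessD, assumption)
  \<comment> \<open>Since \<open>s * k\<close> and \<open>s * ?j\<close> are consecutive multiples
    of \<open>s\<close>, raising the bound releases just one new value.\<close>
  have between: "x \<le> s * ?j \<and> x \<noteq> s * ?j \<longleftrightarrow> x \<le> s * k" if "s dvd x" for x
    using that s by (auto elim!: dvdE simp del: mult_Suc_right)
  have before: "(\<forall>x\<in>#p. x \<le> s * N \<and> (x \<le> k \<longrightarrow> count p x < s) \<and> (s dvd x \<longrightarrow> x \<le> s * k))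
      \<longleftrightarrow> R p \<and> s * ?j \<notin># p" (is "?A \<longleftrightarrow> ?B") for p
  proof
    assume ?A
    then show ?B
      using between[of "s * ?j"] by (auto simp: R_def simp del: mult_Suc_right)
  next
    assume B: ?B
    show ?A
    proof
      fix x assume "x \<in># p"
      then show "x \<le> s * N \<and> (x \<le> k \<longrightarrow> count p x < s) \<and> (s dvd x \<longrightarrow> x \<le> s * k)"
        using B j_le(1) j_free by (cases "x = ?j") (auto simp: R_def simp del: mult_Suc_right)
    qed
  qed
  have after: "(\<forall>x\<in>#p. x \<le> s * N \<and> (x \<le> ?j \<longrightarrow> count p x < s) \<and> (s dvd x \<longrightarrow> x \<le> s * ?j))
      \<longleftrightarrow> R p \<and> count p ?j < s" (is "?A \<longleftrightarrow> ?B") for p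
  proof
    assume A: ?A
    \<comment> \<open>The assumption speaks only of parts that occur; an absent \<open>?j\<close>
      has count 0.\<close>
    have "count p ?j < s"
      using A s by (cases "?j \<in># p") (auto simp: not_in_iff)
    then show ?B
      using A between by (auto simp: R_def simp del: mult_Suc_right)
  next
    assume B: ?B
    show ?A
    proof
      fix x assume "x \<in># p"
      then consider "x = ?j" | "x = s * ?j" | "x \<in># p" "x \<noteq> ?j" "x \<noteq> s * ?j"
        by blast
      then show "x \<le> s * N \<and> (x \<le> ?j \<longrightarrow> count p x < s) \<and> (s dvd x \<longrightarrow> x \<le> s * ?j)"
      proof cases
        case 1
        with B j_le(1) less_j(2) show ?thesis by (metis less_imp_le)
      next
        \<comment> \<open>The multiplicity bound does not reach this part, because it exceeds
          \<open>?j\<close>.\<close>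
        case 2
        with j_le(2) less_j(2) show ?thesis by (metis leD order_refl)
      next
        case 3
        with B between[of x] show ?thesis by (auto simp: R_def le_Suc_eq simp del: mult_Suc_right)
      qed
    qed
  qed
  have "R q" if eq: "\<And>x. x \<noteq> ?j \<Longrightarrow> x \<noteq> s * ?j \<Longrightarrow> count p x = count q x" and "R p" for p q
    unfolding R_def
  proof (intro ballI impI)
    fix x assume x: "x \<in># q" "x \<noteq> ?j" "x \<noteq> s * ?j"
    then have "x \<in># p" using eq[of x] by (metis count_eq_zero_iff)
    then show "x \<le> s * N \<and> (x \<le> k \<longrightarrow> count q x < s) \<and> (s dvd x \<longrightarrow> x \<le> s * k)"
      using \<open>R p\<close>[unfolded R_def] x eq[of x] by metis
  qed
  then have "card {p \<in> partitions_of n. R p \<and> s * ?j \<notin># p} =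
      card {p \<in> partitions_of n. R p \<and> count p ?j < s}"
    by (intro card_partitions_exchange[OF s zero_less_Suc]) blast
  then show ?case
    using Suc.IH[OF Suc_leD[OF Suc.prems]] by (simp only: before after)
qed

theorem theorem1p3:
  fixes s N n :: nat
  assumes "0 < s" and "0 < N"
  shows "card {p \<in> partitions_of n. \<forall>x\<in>#p. \<not> s dvd x \<and> x \<le> s * N} =
         card {p \<in> partitions_of n. (\<forall>x\<in>#p. x \<le> s * N) \<and>
                                    (\<forall>x\<in>#p. x \<le> N \<longrightarrow> count p x \<le> s - 1)}"
proof (cases "s = 1")
  \<comment> \<open>Here \<open>s * j = j\<close>, so there is nothing to exchange. Both conditions
    force the empty multiset: 1 divides every part, and a part at most \<open>N\<close> would have
    to occur 0 times.\<close>
  case True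
  have "(\<forall>x\<in>#p. \<not> s dvd x \<and> x \<le> s * N) \<longleftrightarrow>
      (\<forall>x\<in>#p. x \<le> s * N) \<and> (\<forall>x\<in>#p. x \<le> N \<longrightarrow> count p x \<le> s - 1)" for p
    using True by (cases p) auto
  then show ?thesis by simp
next
  case False
  with \<open>0 < s\<close> have s: "2 \<le> s" by simp
  have "count p x < s \<longleftrightarrow> count p x \<le> s - 1" for p :: "nat multiset" and x
    using \<open>0 < s\<close> by auto
  then show ?thesis
    unfolding card_partitions_stage[OF s order_refl]
    by (intro arg_cong[where f = card]) blast
qed

end
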